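(* Let $s$ and $p$ be positive integers. For $1\le n\le sp+1$, $$|\mathcal{B}^{(s)}_{p,n}| = \sum_{k=1}^{\left\lfloor \frac{ns+1}{ps+1}\right\rfloor}\binom{(n-kp)s}{k-1}.$$ For $n\ge sp+2$, $$|\mathcal{B}^{(s)}_{p,n}| = \sum_{i=0}^{s}\binom{s}{i}|\mathcal{B}^{(s)}_{p,n-1-ip}|.$$
   Context: For positive integers $s,p,n$, take $s$ copies of each integer $k\in\{1,\ldots,n-1\}$ colored with $s$ different colors and denoted $k_1,k_2,\ldots,k_s$. These have the same numerical value $k$ but are distinguishable elements. Define $$\mathcal{B}^{(s)}_{p,n} := \{F\subset \{1_1,\ldots,1_s,\ldots,(n-1)_1,\ldots,(n-1)_s,n\} : n\in F \text{ and } \min F\ge p|F|\},$$ where there is a single copy of $n$, $F$ ranges over subsets of this set of $s(n-1)+1$ distinct elements, $|F|$ is the number of elements of $F$, and $\min F$ is the smallest numerical value of an element of $F$. An empty sum equals $0$. *)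

theory Defs
  imports Main
begin

text \<open>
  The copy \<open>k\<^sub>c\<close> of the integer \<open>k\<close> with color \<open>c\<close> is the pair \<open>(k, c)\<close>, so its numerical value
  is its first component. The single copy of \<open>n\<close> is \<open>(n, 1)\<close>.
\<close>

definition ground :: "nat \<Rightarrow> nat \<Rightarrow> (nat \<times> nat) set" where
  "ground s n = insert (n, 1) ({1..n - 1} \<times> {1..s})"

definition schreier :: "nat \<Rightarrow> nat \<Rightarrow> nat \<Rightarrow> (nat \<times> nat) set set" where
  "schreier s p n = {F. F \<subseteq> ground s n \<and> (n, 1) \<in> F \<and> Min (fst ` F) \<ge> p * card F}"

end

theory Submission
  imports Defs
begin

text \<open>
  Let \<open>F\<close> be a set in \<open>schreier s p n\<close> with \<open>k\<close> elements. Apart from the top element \<open>(n, 1)\<close>, it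
  consists of \<open>k - 1\<close> arbitrary elements among the \<open>(n - k p) s\<close> coloured numbers with values in
  \<open>{k p..n - 1}\<close>; and \<open>k p \<le> n\<close>, because \<open>n\<close> itself is at least the minimum. So, for every
  \<open>n \<ge> 1\<close>, the cardinality of the family is the sum of the binomial coefficients
  \<open>((n - k p) s) choose (k - 1)\<close> over all \<open>k \<ge> 1\<close> with \<open>k p \<le> n\<close> (\<open>card_schreier\<close>).

  Both claims follow from this sum. A summand vanishes unless \<open>k - 1 \<le> (n - k p) s\<close>, that is,
  unless \<open>k (p s + 1) \<le> n s + 1\<close>, which gives the closed form.
  For the recurrence, write \<open>(n - k p) s = s + (n - 1 - k p) s\<close> and apply Vandermonde's identity.
  The term with \<open>i\<close> elements taken from the block of size \<open>s\<close> is \<open>s choose i\<close> times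
  \<open>((n - 1 - k p) s) choose (k - 1 - i)\<close>, and with \<open>j = k - i\<close> the second factor is the summand
  for \<open>j\<close> in the sum for \<open>n - 1 - i p\<close>. Combinatorially, \<open>i\<close> is the number of elements of value
  \<open>n - 1\<close>.
\<close>

definition schreier_layer :: "nat \<Rightarrow> nat \<Rightarrow> nat \<Rightarrow> nat \<Rightarrow> (nat \<times> nat) set set" where
  "schreier_layer s p n k =
     insert (n, 1) ` {G. G \<subseteq> {p * k..n - 1} \<times> {1..s} \<and> card G = k - 1}"

lemma card_mem_schreier_layer:
  assumes "n \<ge> 1" "k \<ge> 1" "F \<in> schreier_layer s p n k"
  shows "card F = k"
proof -
  obtain G where G: "F = insert (n, 1) G" "G \<subseteq> {p * k..n - 1} \<times> {1..s}" "card G = k - 1"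
    using assms(3) by (auto simp: schreier_layer_def)
  have "finite G" using G(2) by (rule finite_subset) simp
  moreover have "(n, 1) \<notin> G" using G(2) assms(1) by fastforce
  ultimately show ?thesis using G assms(2) by simp
qed

lemma card_schreier_layer:
  assumes "n \<ge> 1"
  shows "card (schreier_layer s p n k) = ((n - k * p) * s) choose (k - 1)"
proof -
  let ?B = "{p * k..n - 1} \<times> {1..s}"
  have "(n, 1) \<notin> ?B" using assms by auto
  then have "inj_on (insert (n, 1)) {G. G \<subseteq> ?B \<and> card G = k - 1}"
    by (intro inj_onI) (metis (no_types, lifting) insert_ident mem_Collect_eq subsetD)
  then have "card (schreier_layer s p n k) = card {G. G \<subseteq> ?B \<and> card G = k - 1}"
    unfolding schreier_layer_def by (rule card_image)
  also have "\<dots> = card ?B choose (k - 1)" by (rule n_subsets) simp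
  also have "card ?B = (n - k * p) * s"
    using assms by (simp add: card_cartesian_product mult.commute)
  finally show ?thesis .
qed

lemma mem_schreier_iff:
  assumes "n \<ge> 1"
  shows "F \<in> schreier s p n \<longleftrightarrow>
    F \<subseteq> ground s n \<and> (n, 1) \<in> F \<and> (\<forall>x\<in>F. p * card F \<le> fst x)"
proof (cases "F \<subseteq> ground s n \<and> (n, 1) \<in> F")
  case True
  then have "finite F" by (auto intro: finite_subset simp: ground_def)
  then have "p * card F \<le> Min (fst ` F) \<longleftrightarrow> (\<forall>x\<in>F. p * card F \<le> fst x)"
    using True by (subst Min_ge_iff) auto
  then show ?thesis using True by (simp add: schreier_def)
qed (auto simp: schreier_def)

text \<open>
  The bound \<open>k \<le> n div p\<close> expresses that the top element \<open>(n, 1)\<close> satisfies the Schreier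
  condition, which a layer demands only of the other elements.
\<close>

lemma schreier_eq_Union_layers:
  assumes "n \<ge> 1" "p \<ge> 1"
  shows "schreier s p n = (\<Union>k\<in>{1..n div p}. schreier_layer s p n k)"
proof (intro equalityI subsetI)
  fix F assume "F \<in> schreier s p n"
  then have F: "F \<subseteq> ground s n" "(n, 1) \<in> F" "\<And>x. x \<in> F \<Longrightarrow> p * card F \<le> fst x"
    using mem_schreier_iff[OF assms(1)] by auto
  have fin: "finite F" using F(1) by (rule finite_subset) (simp add: ground_def)
  let ?k = "card F" and ?G = "F - {(n, 1)}"
  have "?k \<ge> 1" using fin F(2) by (auto simp: Suc_le_eq card_gt_0_iff)
  moreover have "?k \<le> n div p"
    using F(3)[OF F(2)] assms(2) by (simp add: less_eq_div_iff_mult_less_eq mult.commute)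
  moreover have "F \<in> schreier_layer s p n ?k"
  proof -
    have "?G \<subseteq> {p * ?k..n - 1} \<times> {1..s}"
    proof
      fix x assume x: "x \<in> ?G"
      then have "x \<in> {1..n - 1} \<times> {1..s}" using F(1) by (auto simp: ground_def)
      then show "x \<in> {p * ?k..n - 1} \<times> {1..s}" using F(3)[of x] x by auto
    qed
    moreover have "card ?G = ?k - 1" using F(2) by simp
    moreover have "F = insert (n, 1) ?G" using F(2) by auto
    ultimately show ?thesis unfolding schreier_layer_def by blast
  qed
  ultimately show "F \<in> (\<Union>k\<in>{1..n div p}. schreier_layer s p n k)" by auto
next
  fix F assume "F \<in> (\<Union>k\<in>{1..n div p}. schreier_layer s p n k)"
  then obtain k where k: "k \<ge> 1" "k \<le> n div p" "F \<in> schreier_layer s p n k" by auto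
  then obtain G where G: "F = insert (n, 1) G" "G \<subseteq> {p * k..n - 1} \<times> {1..s}"
    by (auto simp: schreier_layer_def)
  have "card F = k" using card_mem_schreier_layer assms(1) k by blast
  moreover have "p * k \<ge> 1" using assms(2) k(1) by simp
  moreover have "p * k \<le> n"
    using k(2) assms(2) by (simp add: less_eq_div_iff_mult_less_eq mult.commute)
  moreover have "{p * k..n - 1} \<times> {1..s} \<subseteq> {1..n - 1} \<times> {1..s}"
    using \<open>p * k \<ge> 1\<close> by (intro Sigma_mono) simp_all
  ultimately show "F \<in> schreier s p n"
    using G assms(1) by (auto simp: mem_schreier_iff ground_def)
qed

lemma card_schreier:
  assumes "n \<ge> 1" "p \<ge> 1"
  shows "card (schreier s p n) = (\<Sum>k = 1..n div p. ((n - k * p) * s) choose (k - 1))"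
proof -
  have "card (schreier s p n) = (\<Sum>k = 1..n div p. card (schreier_layer s p n k))"
    unfolding schreier_eq_Union_layers[OF assms]
  proof (rule card_UN_disjoint)
    show "\<forall>k\<in>{1..n div p}. finite (schreier_layer s p n k)"
    proof
      fix k
      have "finite {G. G \<subseteq> {p * k..n - 1} \<times> {1..s}}" by simp
      then show "finite (schreier_layer s p n k)"
        unfolding schreier_layer_def by (auto intro: finite_subset[rotated])
    qed
    show "\<forall>k\<in>{1..n div p}. \<forall>l\<in>{1..n div p}. k \<noteq> l \<longrightarrow>
        schreier_layer s p n k \<inter> schreier_layer s p n l = {}"
      using card_mem_schreier_layer[OF assms(1)]
      by (metis atLeastAtMost_iff disjoint_iff)
  qed simp
  then show ?thesis using card_schreier_layer[OF assms(1)] by simp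
qed

lemma card_schreier_closed_form:
  assumes "n \<ge> 1" "p \<ge> 1" "s \<ge> 1"
  shows "card (schreier s p n)
    = (\<Sum>k = 1..(n * s + 1) div (p * s + 1). ((n - k * p) * s) choose (k - 1))"
  unfolding card_schreier[OF assms(1,2)]
proof (rule sum.mono_neutral_right)
  show "{1..(n * s + 1) div (p * s + 1)} \<subseteq> {1..n div p}"
  proof
    fix k assume k: "k \<in> {1..(n * s + 1) div (p * s + 1)}"
    then have "1 \<le> k" "k * (p * s + 1) \<le> n * s + 1" by (simp_all add: less_eq_div_iff_mult_less_eq)
    from this(2) have "(k * p) * s + k \<le> n * s + 1" by (simp add: algebra_simps)
    then have "(k * p) * s \<le> n * s" using \<open>1 \<le> k\<close> by linarith
    then have "k * p \<le> n" using assms(3) by simp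
    then show "k \<in> {1..n div p}" using k assms(2) by (simp add: less_eq_div_iff_mult_less_eq)
  qed
  show "\<forall>k\<in>{1..n div p} - {1..(n * s + 1) div (p * s + 1)}.
      (n - k * p) * s choose (k - 1) = 0"
  proof
    fix k assume k: "k \<in> {1..n div p} - {1..(n * s + 1) div (p * s + 1)}"
    then have "\<not> k * (p * s + 1) \<le> n * s + 1"
      by (auto simp: less_eq_div_iff_mult_less_eq)
    then have *: "n * s + 1 < (k * p) * s + k" by (simp add: algebra_simps)
    have "k * p \<le> n" using k assms(2) by (simp add: less_eq_div_iff_mult_less_eq)
    then have "(k * p) * s \<le> n * s" by simp
    then have "(n - k * p) * s < k - 1" using * unfolding diff_mult_distrib by linarith
    then show "(n - k * p) * s choose (k - 1) = 0" by (rule binomial_eq_0)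
  qed
qed simp

text \<open>
  Vandermonde's identity with the summation range set by the upper index \<open>s\<close> instead of the
  lower index \<open>r\<close>: the range then stays the same when \<open>r\<close> varies, and the two sums in the
  recurrence can be swapped. The guard excludes \<open>i > r\<close>, where the truncated \<open>r - i = 0\<close> would
  contribute \<open>s choose i\<close>.
\<close>

lemma vandermonde_upper:
  "(s + m) choose r = (\<Sum>i = 0..s. if i \<le> r then (s choose i) * (m choose (r - i)) else 0)"
proof -
  have "(s + m) choose r = (\<Sum>i\<le>r. (s choose i) * (m choose (r - i)))"
    by (rule vandermonde[symmetric])
  also have "\<dots> = (\<Sum>i\<in>{0..s} \<inter> {..r}. (s choose i) * (m choose (r - i)))"
    by (rule sum.mono_neutral_right) (auto simp: binomial_eq_0)
  also have "\<dots> = (\<Sum>i = 0..s. if i \<le> r then (s choose i) * (m choose (r - i)) else 0)"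
    by (subst sum.inter_restrict) auto
  finally show ?thesis .
qed

lemma card_schreier_recurrence:
  assumes n: "n \<ge> s * p + 2" and p: "p \<ge> 1" and s: "s \<ge> 1"
  shows "card (schreier s p n)
    = (\<Sum>i = 0..s. (s choose i) * card (schreier s p (n - 1 - i * p)))"
proof -
  define q where "q = (n - 1) div p"
  define c where "c i k = ((n - 1 - k * p) * s) choose (k - 1 - i)" for i k
  have "p \<le> s * p" using s by simp
  then have "1 * p \<le> n - 1" using n by linarith
  then have q1: "q \<ge> 1"
    unfolding q_def using p by (subst less_eq_div_iff_mult_less_eq) auto
  have le_q: "k \<le> q \<longleftrightarrow> k * p \<le> n - 1" for k
    unfolding q_def using p by (simp add: less_eq_div_iff_mult_less_eq)
  \<comment> \<open>The only index that could be lost is \<open>k = n / p\<close>, and \<open>k \<ge> 2\<close> makes its summand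
      \<open>0 choose (k - 1)\<close> vanish.\<close>
  have "card (schreier s p n) = (\<Sum>k = 1..n div p. ((n - k * p) * s) choose (k - 1))"
    using n p by (intro card_schreier) auto
  also have "\<dots> = (\<Sum>k = 1..q. ((n - k * p) * s) choose (k - 1))"
  proof (rule sum.mono_neutral_right)
    show "{1..q} \<subseteq> {1..n div p}" unfolding q_def by (auto intro: order_trans div_le_mono)
    show "\<forall>k\<in>{1..n div p} - {1..q}. (n - k * p) * s choose (k - 1) = 0"
    proof
      fix k assume k: "k \<in> {1..n div p} - {1..q}"
      then have "k > q" by auto
      then have "n - k * p = 0" using le_q[of k] by simp
      then show "(n - k * p) * s choose (k - 1) = 0" using \<open>k > q\<close> q1 by (simp add: binomial_eq_0)
    qed
  qed simp
  also have "\<dots> = (\<Sum>k = 1..q. \<Sum>i = 0..s. if i \<le> k - 1 then (s choose i) * c i k else 0)"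
  proof (rule sum.cong[OF refl])
    fix k assume "k \<in> {1..q}"
    then have "k * p \<le> n - 1" using le_q by auto
    then have "n - k * p = Suc (n - 1 - k * p)" using n by linarith
    then have "(n - k * p) * s = s + (n - 1 - k * p) * s" by simp
    then show "((n - k * p) * s) choose (k - 1)
        = (\<Sum>i = 0..s. if i \<le> k - 1 then (s choose i) * c i k else 0)"
      by (simp only: vandermonde_upper c_def)
  qed
  also have "\<dots> = (\<Sum>i = 0..s. \<Sum>k = 1..q. if i \<le> k - 1 then (s choose i) * c i k else 0)"
    by (rule sum.swap)
  also have "\<dots> = (\<Sum>i = 0..s. (s choose i) * card (schreier s p (n - 1 - i * p)))"
  proof (rule sum.cong[OF refl])
    fix i assume "i \<in> {0..s}"
    then have "i * p \<le> s * p" by simp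
    then have pos: "n - 1 - i * p \<ge> 1" using n by linarith
    have div: "(n - 1 - i * p) div p = q - i"
    proof -
      have "n - 1 = (n - 1 - i * p) + i * p" using pos by linarith
      then have "q = i + (n - 1 - i * p) div p"
        unfolding q_def using p by (metis div_mult_self1 not_one_le_zero)
      then show ?thesis by simp
    qed
    have "(\<Sum>k = 1..q. if i \<le> k - 1 then (s choose i) * c i k else 0)
        = (\<Sum>k\<in>{1..q} \<inter> {k. i \<le> k - 1}. (s choose i) * c i k)"
      by (subst sum.inter_restrict) auto
    also have "\<dots> = (\<Sum>j = 1..q - i. (s choose i) * c i (j + i))"
      by (rule sum.reindex_bij_witness[where i = "\<lambda>j. j + i" and j = "\<lambda>k. k - i"]) auto
    also have "\<dots> = (s choose i) *
        (\<Sum>j = 1..q - i. ((n - 1 - i * p - j * p) * s) choose (j - 1))"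
      unfolding sum_distrib_left c_def
      by (intro sum.cong refl) (simp add: algebra_simps)
    also have "\<dots> = (s choose i) * card (schreier s p (n - 1 - i * p))"
      using card_schreier[OF pos p] div by simp
    finally show "(\<Sum>k = 1..q. if i \<le> k - 1 then (s choose i) * c i k else 0)
        = (s choose i) * card (schreier s p (n - 1 - i * p))" .
  qed
  finally show ?thesis .
qed

theorem theorem1p5:
  fixes s p :: nat
  assumes "s \<ge> 1" and "p \<ge> 1"
  shows "(\<forall>n. 1 \<le> n \<and> n \<le> s * p + 1 \<longrightarrow>
            card (schreier s p n)
              = (\<Sum>k = 1..(n * s + 1) div (p * s + 1). ((n - k * p) * s) choose (k - 1)))
       \<and> (\<forall>n. n \<ge> s * p + 2 \<longrightarrow>
            card (schreier s p n)
              = (\<Sum>i = 0..s. (s choose i) * card (schreier s p (n - 1 - i * p))))"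
  using card_schreier_closed_form card_schreier_recurrence assms by blast

end
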